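(* Let $0<s<1$ and $1\le p<\infty$. Suppose that $\Omega\subset\mathbb{R}^d$ is a nonempty, bounded, open, $\kappa$-plump set (for some $\kappa\in(0,1)$). If $\underline{\mathrm{co\,dim}}_A(\partial\Omega)>sp$, then there exists a constant $c$ (independent of $f$) such that $$\int_\Omega\frac{|f(x)|^p}{\mathrm{dist}(x,\partial\Omega)^{sp}}\,dx\le c\,\|f\|_{W^{s,p}(\Omega)}^p<\infty\quad\text{for all } f\in W^{s,p}(\Omega).$$
   Context: All functions are real-valued; $|A|$ denotes the Lebesgue measure of $A\subset\mathbb{R}^d$; $B(x,R)$ is the ball with center $x$ and radius $R$, $\overline B(x,R)$ the closed ball; $\mathrm{dist}(x,E)=\inf_{y\in E}|x-y|$. Fractional Sobolev space: $W^{s,p}(\Omega)=\{f\in L^p(\Omega): [f]_{W^{s,p}(\Omega)}<\infty\}$, where $[f]_{W^{s,p}(\Omega)}=\left(\int_\Omega\int_\Omega\frac{|f(x)-f(y)|^p}{|x-y|^{d+sp}}\,dy\,dx\right)^{1/p}$, with norm $\|f\|_{W^{s,p}(\Omega)}=\|f\|_{L^p(\Omega)}+[f]_{W^{s,p}(\Omega)}$. For $E\subset\mathbb{R}^d$ and $r>0$ put $\widetilde E_r=\{x\in\mathbb{R}^d:\mathrm{dist}(x,E)\le r\}$. The lower Assouad codimension $\underline{\mathrm{co\,dim}}_A(E)$ is the supremum of all $q\ge0$ for which there is a constant $C=C(q)\ge1$ such that $|\widetilde E_r\cap B(x,R)|\le C|B(x,R)|(r/R)^q$ for all $x\in E$ and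 $0<r<R<\mathrm{diam}\,E$. A set $E\subset\mathbb{R}^d$ is $\kappa$-plump, with $\kappa\in(0,1)$, if for each $0<r<\mathrm{diam}(E)$ and each $x\in\overline E$ there is $z\in\overline B(x,r)$ such that $B(z,\kappa r)\subset E$. *)

theory Defs
  imports "HOL-Analysis.Analysis"
begin

(* Real powers on [0,\<infinity>]; only positive exponents a are used, so top powr a = top. *)
definition ennreal_powr :: "ennreal \<Rightarrow> real \<Rightarrow> ennreal" where
  "ennreal_powr x a = (if x = top then top else ennreal (enn2real x powr a))"

definition Lp_norm_on :: "real \<Rightarrow> 'a::euclidean_space set \<Rightarrow> ('a \<Rightarrow> real) \<Rightarrow> ennreal" where
  "Lp_norm_on p \<Omega> f =
    ennreal_powr (\<integral>\<^sup>+ x. ennreal (\<bar>f x\<bar> powr p) \<partial>lebesgue_on \<Omega>) (1 / p)"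

(* The integrand is 0 on the diagonal (division by zero). *)
definition gagliardo_seminorm ::
    "real \<Rightarrow> real \<Rightarrow> 'a::euclidean_space set \<Rightarrow> ('a \<Rightarrow> real) \<Rightarrow> ennreal" where
  "gagliardo_seminorm s p \<Omega> f =
    ennreal_powr
      (\<integral>\<^sup>+ x. (\<integral>\<^sup>+ y. ennreal (\<bar>f x - f y\<bar> powr p / norm (x - y) powr (real DIM('a) + s * p))
         \<partial>lebesgue_on \<Omega>) \<partial>lebesgue_on \<Omega>) (1 / p)"

(* Functions are total on the ambient space, but only their values on \<Omega> matter.
   Functions equal almost everywhere are not identified. *)
definition frac_sobolev ::
    "real \<Rightarrow> real \<Rightarrow> 'a::euclidean_space set \<Rightarrow> ('a \<Rightarrow> real) set" where
  "frac_sobolev s p \<Omega> =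
    {f. f \<in> borel_measurable (lebesgue_on \<Omega>) \<and> Lp_norm_on p \<Omega> f < top \<and>
        gagliardo_seminorm s p \<Omega> f < top}"

definition frac_sobolev_norm ::
    "real \<Rightarrow> real \<Rightarrow> 'a::euclidean_space set \<Rightarrow> ('a \<Rightarrow> real) \<Rightarrow> ennreal" where
  "frac_sobolev_norm s p \<Omega> f = Lp_norm_on p \<Omega> f + gagliardo_seminorm s p \<Omega> f"

(* Unlike the real-valued diameter of the library, this is \<infinity> for unbounded sets. *)
definition ediameter :: "'a::metric_space set \<Rightarrow> ennreal" where
  "ediameter E = (SUP (x, y) \<in> E \<times> E. ennreal (dist x y))"

definition closed_nbhd :: "'a::metric_space set \<Rightarrow> real \<Rightarrow> 'a set" where
  "closed_nbhd E r = {x. infdist x E \<le> r}"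

(* The supremum is taken in the extended reals: it is \<infinity> if every q is admissible,
   as happens for sets with at most one point. *)
definition lower_assouad_codim :: "'a::euclidean_space set \<Rightarrow> ereal" where
  "lower_assouad_codim E =
    Sup (ereal ` {q. 0 \<le> q \<and>
      (\<exists>C\<ge>1. \<forall>x\<in>E. \<forall>r R. 0 < r \<and> r < R \<and> ennreal R < ediameter E \<longrightarrow>
        measure lebesgue (closed_nbhd E r \<inter> ball x R)
          \<le> C * measure lebesgue (ball x R) * (r / R) powr q)})"

definition plump :: "real \<Rightarrow> 'a::metric_space set \<Rightarrow> bool" where
  "plump \<kappa> E \<longleftrightarrow> 0 < \<kappa> \<and> \<kappa> < 1 \<and>
    (\<forall>r x. 0 < r \<and> ennreal r < ediameter E \<and> x \<in> closure E \<longrightarrow>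
      (\<exists>z\<in>cball x r. ball z (\<kappa> * r) \<subseteq> E))"

end

theory Submission
  imports Defs
begin

text \<open>
  Write \<open>\<delta> x\<close> for the distance of \<open>x\<close> to the boundary, \<open>d\<close> for the dimension and \<open>\<alpha> = s p\<close>. The proof
  absorbs the left-hand side into itself, by comparing \<open>f x\<close> with the values of \<open>f\<close> at points that
  are much farther from the boundary than \<open>x\<close> is.

  Fix a large number \<open>M\<close>. If \<open>\<delta> x\<close> is small, plumpness at scale \<open>M \<delta> x\<close> gives a set \<open>A x\<close> of points
  \<open>y\<close> in the domain, of measure comparable to \<open>(M \<delta> x)\<^sup>d\<close>, all within \<open>2 M \<delta> x\<close> of \<open>x\<close> and at distance at least
  \<open>\<kappa> M \<delta> x / 2\<close> from the boundary. Splitting \<open>f x\<close> into \<open>f x - f y\<close> and \<open>f y\<close> and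
  averaging over \<open>y\<close> in \<open>A x\<close> bounds \<open>\<bar>f x\<bar>\<^sup>p / (\<delta> x)\<^sup>\<alpha>\<close> by the inner Gagliardo integral at \<open>x\<close>
  (the lemma \<open>hardy_density_le_transfer\<close>; the factor is of order \<open>M\<^sup>\<alpha>\<close>), plus the average of
  \<open>\<bar>f y\<bar>\<^sup>p\<close> over \<open>A x\<close> divided by \<open>(\<delta> x)\<^sup>\<alpha>\<close>.

  Integrate the second summand over \<open>x\<close> and exchange the order of integration. For fixed \<open>y\<close>, the points \<open>x\<close>
  with \<open>y\<close> in \<open>A x\<close> lie in a ball of radius comparable to \<open>\<delta> y\<close>, independently of \<open>M\<close>, and
  within \<open>2 \<delta> y / (\<kappa> M)\<close> of the boundary. The codimension hypothesis, with an
  exponent \<open>q > \<alpha>\<close>, says that they fill at most a fraction of order \<open>M\<^sup>-\<^sup>q\<close> of that ball, whereas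
  \<open>(\<delta> x)\<^sup>-\<^sup>\<alpha>\<close> exceeds \<open>(\<delta> y)\<^sup>-\<^sup>\<alpha>\<close> by a factor of order at most \<open>M\<^sup>\<alpha>\<close>. Hence
  the second summand contributes at most a multiple of \<open>M\<^sup>\<alpha>\<^sup>-\<^sup>q\<close> times the Hardy integral
  (the lemma \<open>transfer_kernel_integral_le\<close>), and this multiple is at most \<open>1/2\<close> once \<open>M\<close> is large.

  Absorption needs a finite left-hand side, so the Hardy integral is first restricted to \<open>\<delta> x \<ge> \<epsilon>\<close>,
  where it is controlled by the \<open>L\<^sup>p\<close> norm. The restriction is stable under the argument because the points of
  \<open>A x\<close> are farther from the boundary than \<open>x\<close>. The bound does not depend on \<open>\<epsilon>\<close>, and
  monotone convergence as \<open>\<epsilon>\<close> tends to zero gives the claim.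
\<close>

section \<open>Powers and extended nonnegative reals\<close>
lemma powr_abs_le_split:
  fixes a b p :: real
  assumes "0 \<le> p"
  shows "\<bar>a\<bar> powr p \<le> 2 powr p * (\<bar>a - b\<bar> powr p + \<bar>b\<bar> powr p)"
proof -
  have "\<bar>a\<bar> \<le> 2 * max \<bar>a - b\<bar> \<bar>b\<bar>"
    using abs_triangle_ineq[of "a - b" b] by (simp add: max_def)
  then have "\<bar>a\<bar> powr p \<le> (2 * max \<bar>a - b\<bar> \<bar>b\<bar>) powr p"
    using assms by (intro powr_mono2) auto
  also have "\<dots> = 2 powr p * max \<bar>a - b\<bar> \<bar>b\<bar> powr p"
    by (simp add: powr_mult)
  also have "max \<bar>a - b\<bar> \<bar>b\<bar> powr p \<le> \<bar>a - b\<bar> powr p + \<bar>b\<bar> powr p"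
    by (simp add: max_def)
  finally show ?thesis by simp
qed

text \<open>
  Each summand of the Sobolev norm is a \<open>p\<close>-th root of an integral; this turns a bound on the
  root into a bound on the integral itself.
\<close>
lemma le_ennreal_powr_of_root_le:
  assumes "0 < p" "ennreal_powr I (1 / p) \<le> N" "N < top"
  shows "I \<le> ennreal_powr N p"
proof -
  have I: "I < top"
    using assms(2,3) by (auto simp: ennreal_powr_def top_unique less_top split: if_splits)
  define i where "i = enn2real I"
  define n where "n = enn2real N"
  have Ii: "I = ennreal i" "N = ennreal n" and "0 \<le> i" "0 \<le> n"
    using I assms(3) by (auto simp: i_def n_def)
  have "i powr (1 / p) \<le> n"
    using assms(2) \<open>0 \<le> n\<close> \<open>0 \<le> i\<close> by (simp add: ennreal_powr_def Ii)
  then have "(i powr (1 / p)) powr p \<le> n powr p"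
    using assms(1) by (intro powr_mono2) auto
  then have "i \<le> n powr p"
    using assms(1) \<open>0 \<le> i\<close> by (simp add: powr_powr)
  then show ?thesis
    using \<open>0 \<le> n\<close> by (simp add: ennreal_powr_def Ii ennreal_leI)
qed

lemma ennreal_powr_less_top: "x < top \<Longrightarrow> ennreal_powr x a < top"
  by (auto simp: ennreal_powr_def)

text \<open>
  The absorption step. Finiteness of \<open>I\<close> is essential: \<open>I = \<infinity>\<close> satisfies the second premise for every \<open>A\<close>.
\<close>
lemma le_twice_of_le_plus_half:
  fixes I A :: ennreal
  assumes "I < top" "I \<le> A + ennreal (1/2) * I"
  shows "I \<le> 2 * A"
proof (cases "A = top")
  case True then show ?thesis by (simp add: ennreal_mult_top)
next
  case False
  obtain i where i: "I = ennreal i" "0 \<le> i" using assms(1) by (cases I) auto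
  obtain a where a: "A = ennreal a" "0 \<le> a" using False by (cases A) auto
  have "ennreal i \<le> ennreal (a + 1/2 * i)"
    using assms(2) i a by (simp only: i a ennreal_plus ennreal_mult' mult_nonneg_nonneg)
  then have "i \<le> a + 1/2 * i" using i a by (subst (asm) ennreal_le_iff) auto
  then have "i \<le> 2 * a" by simp
  then have "ennreal i \<le> ennreal (2 * a)" by (rule ennreal_leI)
  also have "\<dots> = 2 * A" using a by (simp add: ennreal_mult)
  finally show ?thesis using i by simp
qed

section \<open>The boundary of a bounded open set\<close>
lemma ediameter_gt_of_distinct:
  assumes "x \<in> E" "y \<in> E" "x \<noteq> y" "r < dist x y"
  shows "ennreal r < ediameter E"
proof -
  have "ennreal r < ennreal (dist x y)" using assms by (simp add: ennreal_lessI)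
  also have "\<dots> \<le> ediameter E"
    unfolding ediameter_def using assms by (intro SUP_upper2[of "(x, y)"]) auto
  finally show ?thesis .
qed

text \<open>
  A ray from a point of the set leaves it, and so does the opposite ray. Two boundary points make
  the diameter of the boundary positive, so that the codimension hypothesis says something at small scales.
\<close>
lemma frontier_bounded_open_two_points:
  fixes \<Omega> :: "'a::euclidean_space set"
  assumes "\<Omega> \<noteq> {}" "bounded \<Omega>" "open \<Omega>"
  obtains u v where "u \<in> frontier \<Omega>" "v \<in> frontier \<Omega>" "u \<noteq> v"
proof -
  obtain x where x: "x \<in> interior \<Omega>" using assms by (auto simp: interior_open)
  obtain b :: 'a where b: "b \<in> Basis" using nonempty_Basis by blast
  then have "b \<noteq> 0" by auto
  from ray_to_frontier[OF assms(2) x \<open>b \<noteq> 0\<close>]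
  obtain d where d: "0 < d" "x + d *\<^sub>R b \<in> frontier \<Omega>" by metis
  from ray_to_frontier[OF assms(2) x, of "- b"] \<open>b \<noteq> 0\<close>
  obtain e where e: "0 < e" "x + e *\<^sub>R (- b) \<in> frontier \<Omega>" by (metis neg_equal_0_iff_equal)
  have "(d + e) *\<^sub>R b \<noteq> 0" using d e \<open>b \<noteq> 0\<close> by simp
  then have "x + d *\<^sub>R b \<noteq> x + e *\<^sub>R (- b)"
    by (auto simp: algebra_simps)
  with d e that show ?thesis by blast
qed

lemma frontier_bounded_open_nonempty:
  fixes \<Omega> :: "'a::euclidean_space set"
  assumes "\<Omega> \<noteq> {}" "bounded \<Omega>" "open \<Omega>"
  shows "frontier \<Omega> \<noteq> {}"
  using frontier_bounded_open_two_points[OF assms] by blast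

lemma infdist_frontier_pos:
  fixes \<Omega> :: "'a::euclidean_space set"
  assumes "bounded \<Omega>" "open \<Omega>" "x \<in> \<Omega>"
  shows "0 < infdist x (frontier \<Omega>)"
proof -
  have "frontier \<Omega> \<noteq> {}" using frontier_bounded_open_nonempty assms by blast
  moreover have "x \<notin> frontier \<Omega>" using assms by (auto simp: frontier_def interior_open)
  ultimately show ?thesis by (simp add: infdist_pos_not_in_closed frontier_closed)
qed

lemma infdist_frontier_ge_of_ball_subset:
  fixes \<Omega> :: "'a::euclidean_space set"
  assumes "frontier \<Omega> \<noteq> {}" "open \<Omega>" "ball y r \<subseteq> \<Omega>"
  shows "r \<le> infdist y (frontier \<Omega>)"
proof -
  have "r \<le> dist y a" if "a \<in> frontier \<Omega>" for a
    using that assms by (auto simp: frontier_def interior_open not_less[symmetric] subset_eq)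
  then show ?thesis using assms(1) by (auto simp: infdist_def intro!: cINF_greatest)
qed

section \<open>Points far from the boundary\<close>

text \<open>
  The set over which \<open>f\<close> is averaged, for \<open>\<rho> = M \<delta> x\<close>. Taking all points with the
  two properties that the proof exploits, instead of a ball provided by plumpness, avoids a choice of centres
  and makes the dependence on \<open>x\<close> visibly measurable.
\<close>
definition inner_region :: "real \<Rightarrow> 'a::euclidean_space set \<Rightarrow> 'a \<Rightarrow> real \<Rightarrow> 'a set" where
  "inner_region \<kappa> \<Omega> x \<rho> =
    {y \<in> \<Omega>. norm (x - y) \<le> 2 * \<rho> \<and> \<kappa> * \<rho> / 2 \<le> infdist y (frontier \<Omega>)}"

lemma inner_region_subset: "inner_region \<kappa> \<Omega> x \<rho> \<subseteq> \<Omega>"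
  by (auto simp: inner_region_def)

lemma measurable_on_lebesgue_id:
  "(\<lambda>x. x) \<in> lebesgue_on S \<rightarrow>\<^sub>M (borel :: 'a::euclidean_space measure)"
  by (intro measurable_restrict_space1 measurable_completion) simp

lemma measurable_on_lebesgue_infdist:
  "(\<lambda>x. infdist x E) \<in> borel_measurable (lebesgue_on (S :: 'a::euclidean_space set))"
  by (intro measurable_compose[OF measurable_on_lebesgue_id] borel_measurable_continuous_onI
      continuous_on_infdist continuous_on_id)

lemma inner_region_sets:
  fixes \<Omega> :: "'a::euclidean_space set"
  shows "inner_region \<kappa> \<Omega> x \<rho> \<in> sets (lebesgue_on \<Omega>)"
proof -
  note [measurable] = measurable_on_lebesgue_id[of \<Omega>] measurable_on_lebesgue_infdist[of "frontier \<Omega>" \<Omega>]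
  have eq: "inner_region \<kappa> \<Omega> x \<rho> =
      {y \<in> space (lebesgue_on \<Omega>). norm (x - y) \<le> 2 * \<rho> \<and> \<kappa> * \<rho> / 2 \<le> infdist y (frontier \<Omega>)}"
    by (auto simp: inner_region_def)
  show ?thesis unfolding eq by measurable
qed

text \<open>
  Plumpness provides a ball of radius \<open>\<kappa> \<rho>\<close> in the domain; its concentric half lies in the region.
\<close>
lemma emeasure_inner_region_ge:
  fixes \<Omega> :: "'a::euclidean_space set"
  assumes "bounded \<Omega>" "open \<Omega>" "plump \<kappa> \<Omega>" "x \<in> \<Omega>" "0 < \<rho>" "ennreal \<rho> < ediameter \<Omega>"
  shows "ennreal (unit_ball_vol DIM('a) * (\<kappa> * \<rho> / 2) powr DIM('a))
    \<le> emeasure (lebesgue_on \<Omega>) (inner_region \<kappa> \<Omega> x \<rho>)"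
proof -
  have \<kappa>: "0 < \<kappa>" "\<kappa> < 1" using assms(3) by (auto simp: plump_def)
  obtain z where z: "dist x z \<le> \<rho>" "ball z (\<kappa> * \<rho>) \<subseteq> \<Omega>"
    using assms closure_subset[of \<Omega>] unfolding plump_def by (metis mem_cball subsetD)
  have ne: "frontier \<Omega> \<noteq> {}" using frontier_bounded_open_nonempty assms by blast
  have "\<kappa> * \<rho> < \<rho>" and pos: "0 < \<kappa> * \<rho>" using \<kappa> assms(5) by auto
  have sub: "ball z (\<kappa> * \<rho> / 2) \<subseteq> inner_region \<kappa> \<Omega> x \<rho>"
  proof
    fix y assume "y \<in> ball z (\<kappa> * \<rho> / 2)"
    then have y: "dist z y < \<kappa> * \<rho> / 2" by simp
    have "ball y (\<kappa> * \<rho> / 2) \<subseteq> ball z (\<kappa> * \<rho>)"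
    proof
      fix w assume "w \<in> ball y (\<kappa> * \<rho> / 2)"
      then have "dist y w < \<kappa> * \<rho> / 2" by simp
      with y have "dist z w < \<kappa> * \<rho>" using dist_triangle[of z w y] by linarith
      then show "w \<in> ball z (\<kappa> * \<rho>)" by simp
    qed
    with z have b: "ball y (\<kappa> * \<rho> / 2) \<subseteq> \<Omega>" by blast
    then have "\<kappa> * \<rho> / 2 \<le> infdist y (frontier \<Omega>)"
      using infdist_frontier_ge_of_ball_subset ne assms by blast
    moreover have "y \<in> \<Omega>" using b pos by auto
    moreover have "dist x y \<le> 2 * \<rho>"
      using dist_triangle[of x y z] z y \<open>\<kappa> * \<rho> < \<rho>\<close> pos by linarith
    ultimately show "y \<in> inner_region \<kappa> \<Omega> x \<rho>" by (simp add: inner_region_def dist_norm)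
  qed
  have "ennreal (unit_ball_vol DIM('a) * (\<kappa> * \<rho> / 2) powr DIM('a)) = emeasure lebesgue (ball z (\<kappa> * \<rho> / 2))"
    using pos by (simp add: emeasure_ball powr_realpow)
  also have "\<dots> = emeasure (lebesgue_on \<Omega>) (ball z (\<kappa> * \<rho> / 2))"
    using assms sub inner_region_subset by (subst emeasure_restrict_space) fastforce+
  also have "\<dots> \<le> emeasure (lebesgue_on \<Omega>) (inner_region \<kappa> \<Omega> x \<rho>)"
    by (intro emeasure_mono sub inner_region_sets)
  finally show ?thesis .
qed

section \<open>Averaging at a larger scale\<close>
definition gagliardo_density ::
    "real \<Rightarrow> real \<Rightarrow> 'a::euclidean_space set \<Rightarrow> ('a \<Rightarrow> real) \<Rightarrow> 'a \<Rightarrow> ennreal" where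
  "gagliardo_density \<alpha> p \<Omega> f x =
    (\<integral>\<^sup>+ y. ennreal (\<bar>f x - f y\<bar> powr p / norm (x - y) powr (real DIM('a) + \<alpha>)) \<partial>lebesgue_on \<Omega>)"

lemma gagliardo_kernel_measurable:
  fixes \<Omega> :: "'a::euclidean_space set"
  assumes [measurable]: "f \<in> borel_measurable (lebesgue_on \<Omega>)"
  shows "(\<lambda>(x, y). ennreal (\<bar>f x - f y\<bar> powr p / norm (x - y) powr a))
    \<in> borel_measurable (lebesgue_on \<Omega> \<Otimes>\<^sub>M lebesgue_on \<Omega>)"
proof -
  note [measurable] = measurable_on_lebesgue_id[of \<Omega>]
  show ?thesis by measurable
qed

lemma sigma_finite_lebesgue_on_bounded_open:
  fixes \<Omega> :: "'a::euclidean_space set"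
  assumes "bounded \<Omega>" "open \<Omega>"
  shows "sigma_finite_measure (lebesgue_on \<Omega>)"
  using assms finite_measure_lebesgue_on lmeasurable_open finite_measure.axioms(1) by blast

lemma gagliardo_density_measurable:
  fixes \<Omega> :: "'a::euclidean_space set"
  assumes "bounded \<Omega>" "open \<Omega>" "f \<in> borel_measurable (lebesgue_on \<Omega>)"
  shows "gagliardo_density \<alpha> p \<Omega> f \<in> borel_measurable (lebesgue_on \<Omega>)"
  unfolding gagliardo_density_def
  by (intro sigma_finite_measure.borel_measurable_nn_integral sigma_finite_lebesgue_on_bounded_open
      gagliardo_kernel_measurable assms)

text \<open>
  The constant produced by splitting \<open>f x\<close> (the numerator) and dividing by the lower bound for the
  measure of the inner region at unit scale (the denominator).
\<close>
definition averaging_const :: "real \<Rightarrow> real \<Rightarrow> real \<Rightarrow> real" where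
  "averaging_const d p \<kappa> = 2 powr p / (unit_ball_vol d * (\<kappa> / 2) powr d)"

text \<open>
  Average \<open>\<bar>f x\<bar>\<^sup>p \<le> 2\<^sup>p (\<bar>f x - f y\<bar>\<^sup>p + \<bar>f y\<bar>\<^sup>p)\<close> over \<open>y\<close> in the inner region. There
  \<open>\<bar>x - y\<bar> \<le> 2 \<rho>\<close>, so the difference is at most \<open>(2 \<rho>)\<^sup>d\<^sup>+\<^sup>\<alpha>\<close> times the Gagliardo kernel. Dividing by
  the measure of the region, which is of order \<open>\<rho>\<^sup>d\<close>, leaves \<open>\<rho>\<^sup>\<alpha>\<close> in front of the Gagliardo density.
\<close>
lemma powr_le_gagliardo_plus_inner_average:
  fixes \<Omega> :: "'a::euclidean_space set" and \<alpha> :: real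
  assumes \<Omega>: "bounded \<Omega>" "open \<Omega>" "plump \<kappa> \<Omega>" and x: "x \<in> \<Omega>"
    and \<rho>: "0 < \<rho>" "ennreal \<rho> < ediameter \<Omega>"
    and f: "f \<in> borel_measurable (lebesgue_on \<Omega>)" and p: "0 \<le> p" and \<alpha>: "0 \<le> \<alpha>"
  defines "K \<equiv> averaging_const DIM('a) p \<kappa>"
  shows "ennreal (\<bar>f x\<bar> powr p * \<rho> powr (- \<alpha>))
    \<le> ennreal (K * 2 powr (DIM('a) + \<alpha>)) * gagliardo_density \<alpha> p \<Omega> f x
      + ennreal (K * \<rho> powr (- (DIM('a) + \<alpha>))) *
        (\<integral>\<^sup>+ y. ennreal (\<bar>f y\<bar> powr p) * indicator (inner_region \<kappa> \<Omega> x \<rho>) y \<partial>lebesgue_on \<Omega>)"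
    (is "_ \<le> _ * ?G + _ * ?J")
proof -
  let ?L = "lebesgue_on \<Omega>" and ?S = "inner_region \<kappa> \<Omega> x \<rho>"
  define d :: real where "d = DIM('a)"
  define w where "w = unit_ball_vol d * (\<kappa> / 2) powr d"
  have \<kappa>: "0 < \<kappa>" using \<Omega> by (simp add: plump_def)
  have w: "0 < w" using \<kappa> by (simp add: w_def d_def)
  have d: "0 < d" by (simp add: d_def)
  note [measurable] = f inner_region_sets[of \<kappa> \<Omega> x \<rho>] measurable_on_lebesgue_id[of \<Omega>]
  let ?k = "\<lambda>y. \<bar>f x - f y\<bar> powr p / norm (x - y) powr (d + \<alpha>)"
  have pt: "ennreal (\<bar>f x\<bar> powr p) * indicator ?S y
      \<le> ennreal (2 powr p * (2 * \<rho>) powr (d + \<alpha>)) * ennreal (?k y)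
        + ennreal (2 powr p) * (ennreal (\<bar>f y\<bar> powr p) * indicator ?S y)" for y
  proof (cases "y \<in> ?S")
    case True
    then have n: "norm (x - y) \<le> 2 * \<rho>" by (simp add: inner_region_def)
    have "\<bar>f x - f y\<bar> powr p \<le> (2 * \<rho>) powr (d + \<alpha>) * ?k y"
    \<comment> \<open>On the diagonal the kernel is zero by division by zero, and so is the left-hand side.\<close>
    proof (cases "x = y")
      case False
      then have "norm (x - y) powr (d + \<alpha>) * ?k y \<le> (2 * \<rho>) powr (d + \<alpha>) * ?k y"
        using n d \<alpha> by (intro mult_right_mono powr_mono2) auto
      then show ?thesis using False by simp
    qed simp
    then have "\<bar>f x\<bar> powr p \<le> 2 powr p * ((2 * \<rho>) powr (d + \<alpha>) * ?k y + \<bar>f y\<bar> powr p)"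
      by (intro order_trans[OF powr_abs_le_split[OF p, of "f x" "f y"]] mult_left_mono add_mono) auto
    then have "ennreal (\<bar>f x\<bar> powr p)
      \<le> ennreal (2 powr p * (2 * \<rho>) powr (d + \<alpha>) * ?k y + 2 powr p * \<bar>f y\<bar> powr p)"
      by (intro ennreal_leI) (simp add: algebra_simps)
    then show ?thesis using True by (simp add: ennreal_mult'[symmetric])
  qed simp
  have "ennreal (\<bar>f x\<bar> powr p) * ennreal (w * \<rho> powr d) \<le> ennreal (\<bar>f x\<bar> powr p) * emeasure ?L ?S"
  proof (rule mult_left_mono)
    have "w * \<rho> powr d = unit_ball_vol d * (\<kappa> * \<rho> / 2) powr d"
      using \<kappa> \<rho> by (simp add: w_def powr_mult[symmetric])
    then show "ennreal (w * \<rho> powr d) \<le> emeasure ?L ?S"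
      using emeasure_inner_region_ge[OF \<Omega> x \<rho>] by (simp add: d_def)
  qed simp
  also have "\<dots> = (\<integral>\<^sup>+ y. ennreal (\<bar>f x\<bar> powr p) * indicator ?S y \<partial>?L)"
    by (simp add: nn_integral_cmult_indicator)
  also have "\<dots> \<le> (\<integral>\<^sup>+ y. ennreal (2 powr p * (2 * \<rho>) powr (d + \<alpha>)) * ennreal (?k y)
        + ennreal (2 powr p) * (ennreal (\<bar>f y\<bar> powr p) * indicator ?S y) \<partial>?L)"
    by (intro nn_integral_mono pt)
  also have "\<dots> = ennreal (2 powr p * (2 * \<rho>) powr (d + \<alpha>)) * ?G + ennreal (2 powr p) * ?J"
    by (subst nn_integral_add; (subst nn_integral_cmult)?)
       (auto simp: gagliardo_density_def d_def nn_integral_cmult)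
  finally have *: "ennreal (\<bar>f x\<bar> powr p) * ennreal (w * \<rho> powr d)
    \<le> ennreal (2 powr p * (2 * \<rho>) powr (d + \<alpha>)) * ?G + ennreal (2 powr p) * ?J" .
  \<comment> \<open>Normalise: \<open>u\<close> is the reciprocal of \<open>w \<rho>\<^sup>d\<close>, times \<open>\<rho>\<^sup>-\<^sup>\<alpha>\<close>.\<close>
  define u where "u = \<rho> powr (- (d + \<alpha>)) / w"
  have u: "0 \<le> u" using w by (simp add: u_def)
  have "ennreal u * (ennreal (\<bar>f x\<bar> powr p) * ennreal (w * \<rho> powr d))
    \<le> ennreal u * (ennreal (2 powr p * (2 * \<rho>) powr (d + \<alpha>)) * ?G + ennreal (2 powr p) * ?J)"
    by (rule mult_left_mono[OF *]) simp
  then have "ennreal (u * (\<bar>f x\<bar> powr p * (w * \<rho> powr d)))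
    \<le> ennreal (u * (2 powr p * (2 * \<rho>) powr (d + \<alpha>))) * ?G + ennreal (u * 2 powr p) * ?J"
    using u w by (simp add: distrib_left ennreal_mult mult.assoc)
  moreover have "u * (\<bar>f x\<bar> powr p * (w * \<rho> powr d)) = \<bar>f x\<bar> powr p * \<rho> powr (- \<alpha>)"
  proof -
    have "\<rho> powr (- (d + \<alpha>)) * \<rho> powr d = \<rho> powr (- \<alpha>)"
      by (simp add: powr_add[symmetric])
    then show ?thesis using w by (simp add: u_def field_simps)
  qed
  moreover have "u * (2 powr p * (2 * \<rho>) powr (d + \<alpha>)) = K * 2 powr (DIM('a) + \<alpha>)"
  proof -
    have "\<rho> powr (- (d + \<alpha>)) * (2 * \<rho>) powr (d + \<alpha>) = 2 powr (d + \<alpha>)"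
    proof -
      have "\<rho> powr (- (d + \<alpha>)) * \<rho> powr (d + \<alpha>) = 1"
        using \<rho> by (subst powr_add[symmetric]) simp
      then show ?thesis using \<rho> by (simp add: powr_mult)
    qed
    moreover have "u * (2 powr p * (2 * \<rho>) powr (d + \<alpha>))
        = 2 powr p / w * (\<rho> powr (- (d + \<alpha>)) * (2 * \<rho>) powr (d + \<alpha>))"
      by (simp add: u_def)
    ultimately show ?thesis by (simp only: K_def averaging_const_def w_def d_def)
  qed
  moreover have "u * 2 powr p = K * \<rho> powr (- (DIM('a) + \<alpha>))"
    by (simp add: u_def K_def averaging_const_def w_def d_def)
  ultimately show ?thesis by simp
qed

text \<open>
  The kernel that carries mass from \<open>y\<close> to \<open>x\<close>: up to a constant and a power of \<open>M\<close>, its integral in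
  \<open>y\<close> is the average of \<open>\<bar>f y\<bar>\<^sup>p\<close> over the inner region of \<open>x\<close>, divided by \<open>(\<delta> x)\<^sup>\<alpha>\<close>. It is a
  function of both points so that the order of integration can be exchanged.
\<close>
definition transfer_kernel ::
    "real \<Rightarrow> 'a::euclidean_space set \<Rightarrow> real \<Rightarrow> real \<Rightarrow> real \<Rightarrow> ('a \<Rightarrow> real) \<Rightarrow> 'a \<Rightarrow> 'a \<Rightarrow> ennreal" where
  "transfer_kernel \<kappa> \<Omega> M \<alpha> p f x y =
    ennreal (infdist x (frontier \<Omega>) powr (- (real DIM('a) + \<alpha>)) * \<bar>f y\<bar> powr p) *
      indicator (inner_region \<kappa> \<Omega> x (M * infdist x (frontier \<Omega>))) y"

lemma transfer_kernel_measurable: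
  fixes \<Omega> :: "'a::euclidean_space set"
  assumes [measurable]: "f \<in> borel_measurable (lebesgue_on \<Omega>)"
  shows "case_prod (transfer_kernel \<kappa> \<Omega> M \<alpha> p f)
    \<in> borel_measurable (lebesgue_on \<Omega> \<Otimes>\<^sub>M lebesgue_on \<Omega>)"
proof -
  let ?\<delta> = "\<lambda>x. infdist x (frontier \<Omega>)"
  note [measurable] = measurable_on_lebesgue_id[of \<Omega>] measurable_on_lebesgue_infdist[of "frontier \<Omega>" \<Omega>]
  have "(\<lambda>(x, y). if norm (x - y) \<le> 2 * (M * ?\<delta> x) \<and> \<kappa> * (M * ?\<delta> x) / 2 \<le> ?\<delta> y
      then ennreal (?\<delta> x powr (- (real DIM('a) + \<alpha>)) * \<bar>f y\<bar> powr p) else 0)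
    \<in> borel_measurable (lebesgue_on \<Omega> \<Otimes>\<^sub>M lebesgue_on \<Omega>)"
    by measurable
  then show ?thesis
    by (rule measurable_cong[THEN iffD1, rotated])
       (auto simp: transfer_kernel_def inner_region_def space_pair_measure)
qed

text \<open>
  The averaging estimate at \<open>\<rho> = M \<delta> x\<close>, multiplied by \<open>M\<^sup>\<alpha>\<close>. What matters is the power of
  \<open>M\<close> in the second summand: \<open>M\<^sup>-\<^sup>d\<close> is the gain from averaging over a set of measure of order \<open>(M \<delta> x)\<^sup>d\<close>.
\<close>
lemma hardy_density_le_transfer:
  fixes \<Omega> :: "'a::euclidean_space set" and \<alpha> :: real
  defines "\<delta> \<equiv> \<lambda>x. infdist x (frontier \<Omega>)"
  defines "K p \<kappa> \<equiv> averaging_const DIM('a) p \<kappa>"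
  assumes \<Omega>: "bounded \<Omega>" "open \<Omega>" "plump \<kappa> \<Omega>" and x: "x \<in> \<Omega>"
    and M: "0 < M" "ennreal (M * \<delta> x) < ediameter \<Omega>"
    and f: "f \<in> borel_measurable (lebesgue_on \<Omega>)" and p: "0 \<le> p" and \<alpha>: "0 \<le> \<alpha>"
  shows "ennreal (\<bar>f x\<bar> powr p / \<delta> x powr \<alpha>)
    \<le> ennreal (K p \<kappa> * 2 powr (DIM('a) + \<alpha>) * M powr \<alpha>) * gagliardo_density \<alpha> p \<Omega> f x
      + ennreal (K p \<kappa> * M powr (- real DIM('a))) *
        (\<integral>\<^sup>+ y. transfer_kernel \<kappa> \<Omega> M \<alpha> p f x y \<partial>lebesgue_on \<Omega>)"
proof -
  define d where "d = real DIM('a)"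
  define t where "t = \<delta> x"
  define k where "k = K p \<kappa>"
  define G where "G = gagliardo_density \<alpha> p \<Omega> f x"
  define J where "J = (\<integral>\<^sup>+ y. ennreal (\<bar>f y\<bar> powr p) * indicator (inner_region \<kappa> \<Omega> x (M * t)) y \<partial>lebesgue_on \<Omega>)"
  have t: "0 < t" using infdist_frontier_pos[OF \<Omega>(1,2) x] by (simp add: t_def \<delta>_def)
  have k: "0 \<le> k" by (simp add: k_def K_def averaging_const_def)
  note [measurable] = f inner_region_sets[of \<kappa> \<Omega> x "M * t"]
  have "transfer_kernel \<kappa> \<Omega> M \<alpha> p f x = (\<lambda>y. ennreal (t powr (- (d + \<alpha>))) *
      (ennreal (\<bar>f y\<bar> powr p) * indicator (inner_region \<kappa> \<Omega> x (M * t)) y))"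
    by (rule ext) (simp add: transfer_kernel_def ennreal_mult' mult.assoc t_def \<delta>_def d_def)
  then have J: "(\<integral>\<^sup>+ y. transfer_kernel \<kappa> \<Omega> M \<alpha> p f x y \<partial>lebesgue_on \<Omega>) = ennreal (t powr (- (d + \<alpha>))) * J"
    unfolding J_def by (simp only:) (rule nn_integral_cmult, measurable)
  have "ennreal (\<bar>f x\<bar> powr p * (M * t) powr (- \<alpha>))
      \<le> ennreal (k * 2 powr (d + \<alpha>)) * G + ennreal (k * (M * t) powr (- (d + \<alpha>))) * J"
    using powr_le_gagliardo_plus_inner_average[OF \<Omega> x _ _ f p \<alpha>, of "M * t"] M t
    by (simp add: k_def K_def d_def G_def J_def t_def)
  then have "ennreal (M powr \<alpha>) * ennreal (\<bar>f x\<bar> powr p * (M * t) powr (- \<alpha>))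
      \<le> ennreal (M powr \<alpha>) *
         (ennreal (k * 2 powr (d + \<alpha>)) * G + ennreal (k * (M * t) powr (- (d + \<alpha>))) * J)"
    by (rule mult_left_mono) simp
  then have *: "ennreal (M powr \<alpha> * (\<bar>f x\<bar> powr p * (M * t) powr (- \<alpha>)))
      \<le> ennreal (M powr \<alpha> * (k * 2 powr (d + \<alpha>))) * G
        + ennreal (M powr \<alpha> * (k * (M * t) powr (- (d + \<alpha>)))) * J"
    by (simp only: distrib_left ennreal_mult' mult.assoc powr_ge_zero)
  have 1: "M powr \<alpha> * (\<bar>f x\<bar> powr p * (M * t) powr (- \<alpha>)) = \<bar>f x\<bar> powr p / t powr \<alpha>"
    using M t by (simp add: powr_mult powr_minus field_simps)
  have 2: "M powr \<alpha> * (k * 2 powr (d + \<alpha>)) = k * 2 powr (d + \<alpha>) * M powr \<alpha>"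
    by simp
  have "M powr \<alpha> * M powr (- (d + \<alpha>)) = M powr (- d)"
    by (subst powr_add[symmetric]) simp
  moreover have "(M * t) powr (- (d + \<alpha>)) = M powr (- (d + \<alpha>)) * t powr (- (d + \<alpha>))"
    using M t by (simp add: powr_mult)
  ultimately have 3: "M powr \<alpha> * (k * (M * t) powr (- (d + \<alpha>))) = k * M powr (- d) * t powr (- (d + \<alpha>))"
    by (metis mult.assoc mult.commute)
  have "ennreal (k * M powr (- d) * t powr (- (d + \<alpha>))) * J
      = ennreal (k * M powr (- d)) * (ennreal (t powr (- (d + \<alpha>))) * J)"
    using k by (simp add: ennreal_mult mult.assoc)
  with * show ?thesis
    unfolding 1 2 3 J by (simp add: k_def d_def G_def t_def)
qed

section \<open>Exchanging the order of integration\<close>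

text \<open>
  The inequality that makes \<open>q\<close> admissible in the lower Assouad codimension of \<open>E\<close>, with constant \<open>C\<close>.
\<close>
definition assouad_thin :: "'a::euclidean_space set \<Rightarrow> real \<Rightarrow> real \<Rightarrow> bool" where
  "assouad_thin E q C \<longleftrightarrow> (\<forall>x\<in>E. \<forall>r R. 0 < r \<and> r < R \<and> ennreal R < ediameter E \<longrightarrow>
    measure lebesgue (closed_nbhd E r \<inter> ball x R)
      \<le> C * measure lebesgue (ball x R) * (r / R) powr q)"

text \<open>
  Let \<open>t = \<delta> y\<close>. If \<open>y\<close> lies in the inner region of \<open>x\<close>, then \<open>\<kappa> M \<delta> x / 2 \<le> t\<close> and
  \<open>\<bar>x - y\<bar> \<le> 2 M \<delta> x \<le> 4 t / \<kappa>\<close>. So \<open>x\<close> is within \<open>r = 2 t / (\<kappa> M)\<close> of the boundary and within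
  \<open>4 t / \<kappa> + t < 6 t / \<kappa>\<close> of a boundary point nearest to \<open>y\<close>. The ratio of the two radii \<open>r\<close>
  and \<open>R = 6 t / \<kappa>\<close> is \<open>1 / (3 M)\<close>.
\<close>
lemma emeasure_inner_region_preimage_le:
  fixes \<Omega> :: "'a::euclidean_space set"
  assumes \<Omega>: "bounded \<Omega>" "open \<Omega>" and \<kappa>: "0 < \<kappa>" "\<kappa> < 1"
    and M: "2 / \<kappa> \<le> M" and y: "y \<in> \<Omega>"
    and R_small: "ennreal (6 / \<kappa> * infdist y (frontier \<Omega>)) < ediameter (frontier \<Omega>)"
    and C: "assouad_thin (frontier \<Omega>) q C"
  shows "emeasure (lebesgue_on \<Omega>) {x \<in> \<Omega>. y \<in> inner_region \<kappa> \<Omega> x (M * infdist x (frontier \<Omega>))}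
    \<le> ennreal (C * (unit_ball_vol DIM('a) * (6 / \<kappa> * infdist y (frontier \<Omega>)) powr DIM('a))
         * (3 * M) powr (- q))"
    (is "emeasure _ ?T \<le> _")
proof -
  let ?E = "frontier \<Omega>"
  define t where "t = infdist y ?E"
  have t: "0 < t" using infdist_frontier_pos[OF \<Omega> y] by (simp add: t_def)
  have ne: "?E \<noteq> {}" using frontier_bounded_open_nonempty \<Omega> y by blast
  obtain e where e: "e \<in> ?E" "infdist y ?E = dist y e"
    using infdist_attains_inf[OF frontier_closed ne] by metis
  have "2 < 2 / \<kappa>" using \<kappa> by (simp add: less_divide_eq)
  with M have M2: "2 < M" by linarith
  define r where "r = 2 * t / (\<kappa> * M)"
  define R where "R = 6 / \<kappa> * t"
  have "0 < r" using t \<kappa> M2 by (simp add: r_def)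
  have rR: "r / R = 1 / (3 * M)" using t \<kappa> M2 by (simp add: r_def R_def field_simps)
  have "0 < R" using t \<kappa> by (simp add: R_def)
  moreover have "r / R < 1" using rR M2 by simp
  ultimately have "r < R" by (simp add: divide_less_eq_1_pos)
  have Rlt: "ennreal R < ediameter ?E" using R_small unfolding R_def t_def .
  have sub: "?T \<subseteq> closed_nbhd ?E r \<inter> ball e R"
  proof
    fix x assume "x \<in> ?T"
    then have 1: "norm (x - y) \<le> 2 * (M * infdist x ?E)" and 2: "\<kappa> * (M * infdist x ?E) / 2 \<le> t"
      by (auto simp: inner_region_def t_def)
    have xr: "infdist x ?E \<le> r"
      using 2 \<kappa> M2 by (simp add: r_def field_simps)
    have "2 * (M * infdist x ?E) \<le> 4 / \<kappa> * t"
      using 2 \<kappa> by (simp add: field_simps)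
    moreover have "4 / \<kappa> * t + t < R"
      using \<kappa> t by (simp add: R_def field_simps)
    ultimately have "dist e x < R"
      using dist_triangle[of e x y] 1 e by (simp add: dist_commute dist_norm t_def)
    then show "x \<in> closed_nbhd ?E r \<inter> ball e R" using xr by (simp add: closed_nbhd_def)
  qed
  have meas: "closed_nbhd ?E r \<inter> ball e R \<in> lmeasurable"
  proof -
    have "closed (closed_nbhd ?E r)"
      unfolding closed_nbhd_def by (intro closed_Collect_le continuous_intros continuous_on_infdist)
    then show ?thesis
      using lmeasurable_ball by (metis borel_closed inf_commute fmeasurable_Int_fmeasurable sets_completionI_sets sets_lborel)
  qed
  have "emeasure (lebesgue_on \<Omega>) ?T = emeasure lebesgue ?T"
    using \<Omega> by (intro emeasure_restrict_space) auto
  also have "\<dots> \<le> emeasure lebesgue (closed_nbhd ?E r \<inter> ball e R)"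
    by (intro emeasure_mono sub fmeasurableD meas)
  also have "\<dots> = ennreal (measure lebesgue (closed_nbhd ?E r \<inter> ball e R))"
    using meas by (intro emeasure_eq_ennreal_measure) (auto simp: fmeasurable_def)
  also have "\<dots> \<le> ennreal (C * measure lebesgue (ball e R) * (r / R) powr q)"
    using C[unfolded assouad_thin_def] e(1) \<open>0 < r\<close> \<open>r < R\<close> Rlt by (intro ennreal_leI) blast
  also have "measure lebesgue (ball e R) = unit_ball_vol DIM('a) * R powr DIM('a)"
    using \<open>0 < R\<close> by (simp add: content_ball powr_realpow)
  also have "(r / R) powr q = (3 * M) powr (- q)"
    using M2 by (simp add: rR powr_divide powr_minus_divide)
  finally show ?thesis by (simp add: R_def t_def)
qed

text \<open>
  Tonelli's theorem followed by the preceding measure estimate. On the support of the kernel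
  \<open>\<delta> y \<le> \<delta> x + 2 M \<delta> x \<le> 3 M \<delta> x\<close>, which bounds the power of \<open>\<delta> x\<close> in terms of \<open>\<delta> y\<close> and, with
  \<open>\<delta> x \<le> r0\<close>, keeps the radius \<open>6 \<delta> y / \<kappa>\<close> below the diameter of the boundary. Also
  \<open>\<delta> y \<ge> \<kappa> M \<delta> x / 2 \<ge> \<delta> x\<close>, because \<open>M \<ge> 2 / \<kappa>\<close>, so the truncation at \<open>\<epsilon>\<close> carries over from \<open>x\<close> to \<open>y\<close>.
\<close>
lemma transfer_kernel_integral_le:
  fixes \<Omega> :: "'a::euclidean_space set" and \<alpha> C q :: real
  defines "\<delta> \<equiv> \<lambda>x. infdist x (frontier \<Omega>)" and "d \<equiv> real DIM('a)"
  assumes \<Omega>: "bounded \<Omega>" "open \<Omega>" and \<kappa>: "0 < \<kappa>" "\<kappa> < 1"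
    and M: "2 / \<kappa> \<le> M"
    and r0: "ennreal (18 * M / \<kappa> * r0) < ediameter (frontier \<Omega>)"
    and f: "f \<in> borel_measurable (lebesgue_on \<Omega>)" and \<alpha>: "0 \<le> \<alpha>" and C0: "0 \<le> C"
    and C: "assouad_thin (frontier \<Omega>) q C"
  shows "(\<integral>\<^sup>+ x. indicator {\<epsilon>..r0} (\<delta> x) *
        (\<integral>\<^sup>+ y. transfer_kernel \<kappa> \<Omega> M \<alpha> p f x y \<partial>lebesgue_on \<Omega>) \<partial>lebesgue_on \<Omega>)
    \<le> ennreal (C * unit_ball_vol d * (6 / \<kappa>) powr d * (3 * M) powr (d + \<alpha> - q)) *
        (\<integral>\<^sup>+ y. ennreal (\<bar>f y\<bar> powr p / \<delta> y powr \<alpha>) * indicator {\<epsilon>..} (\<delta> y) \<partial>lebesgue_on \<Omega>)"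
    (is "?lhs \<le> ennreal ?B * _")
proof -
  let ?L = "lebesgue_on \<Omega>"
  have "2 < 2 / \<kappa>" using \<kappa> by (simp add: less_divide_eq)
  with M have M2: "2 < M" by linarith
  have sp: "space ?L = \<Omega>" by simp
  interpret L: sigma_finite_measure ?L by (rule sigma_finite_lebesgue_on_bounded_open[OF \<Omega>])
  interpret pair_sigma_finite ?L ?L ..
  define P where "P x y \<longleftrightarrow> \<delta> x \<in> {\<epsilon>..r0} \<and> y \<in> inner_region \<kappa> \<Omega> x (M * \<delta> x)" for x y
  define k where "k x y = indicator {\<epsilon>..r0} (\<delta> x) * transfer_kernel \<kappa> \<Omega> M \<alpha> p f x y" for x y
  have \<delta>_meas: "\<delta> \<in> borel_measurable ?L" unfolding \<delta>_def by (rule measurable_on_lebesgue_infdist)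
  note [measurable] = f \<delta>_meas measurable_on_lebesgue_id[of \<Omega>] transfer_kernel_measurable[OF f]
  have k_meas: "case_prod k \<in> borel_measurable (?L \<Otimes>\<^sub>M ?L)"
    unfolding k_def by measurable
  have k_eq: "k x y = (if P x y then ennreal (\<delta> x powr (- (d + \<alpha>)) * \<bar>f y\<bar> powr p) else 0)" for x y
    by (simp add: indicator_def k_def P_def transfer_kernel_def \<delta>_def d_def)
  have "?lhs = (\<integral>\<^sup>+ x. (\<integral>\<^sup>+ y. k x y \<partial>?L) \<partial>?L)"
    unfolding k_def by (intro nn_integral_cong nn_integral_cmult[symmetric]) measurable
  also have "\<dots> = (\<integral>\<^sup>+ y. (\<integral>\<^sup>+ x. k x y \<partial>?L) \<partial>?L)"
    by (rule Fubini'[OF k_meas, symmetric])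
  also have "\<dots> \<le> (\<integral>\<^sup>+ y. ennreal ?B * (ennreal (\<bar>f y\<bar> powr p / \<delta> y powr \<alpha>) * indicator {\<epsilon>..} (\<delta> y)) \<partial>?L)"
  proof (rule nn_integral_mono)
    fix y assume "y \<in> space ?L"
    then have y: "y \<in> \<Omega>" by (simp add: sp)
    define t where "t = \<delta> y"
    have t: "0 < t" using infdist_frontier_pos[OF \<Omega> y] by (simp add: t_def \<delta>_def)
    let ?T = "{x \<in> \<Omega>. y \<in> inner_region \<kappa> \<Omega> x (M * \<delta> x)}"
    have T_sets: "?T \<in> sets ?L"
    proof -
      have eq: "?T = {x \<in> space ?L. norm (x - y) \<le> 2 * (M * \<delta> x) \<and> \<kappa> * (M * \<delta> x) / 2 \<le> \<delta> y}"
        using y unfolding inner_region_def sp \<delta>_def by auto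
      show ?thesis unfolding eq by measurable
    qed
    show "(\<integral>\<^sup>+ x. k x y \<partial>?L) \<le> ennreal ?B * (ennreal (\<bar>f y\<bar> powr p / \<delta> y powr \<alpha>) * indicator {\<epsilon>..} (\<delta> y))"
    proof (cases "\<exists>x\<in>\<Omega>. P x y")
      case False
      then have "(\<integral>\<^sup>+ x. k x y \<partial>?L) = (\<integral>\<^sup>+ x. 0 \<partial>?L)"
        by (intro nn_integral_cong) (auto simp: k_eq sp)
      then show ?thesis by simp
    next
      case True
      have lower: "t \<le> 3 * M * \<delta> x" if "P x y" for x
      proof -
        have "t \<le> \<delta> x + norm (x - y)"
          using infdist_triangle[of y "frontier \<Omega>" x] by (simp add: t_def \<delta>_def dist_norm norm_minus_commute)
        moreover have "0 \<le> \<delta> x" by (simp add: \<delta>_def infdist_nonneg)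
        ultimately have "t \<le> \<delta> x + 2 * (M * \<delta> x)" using that by (simp add: P_def inner_region_def)
        moreover have "\<delta> x \<le> M * \<delta> x" using \<open>0 \<le> \<delta> x\<close> M2 by (simp add: mult_le_cancel_right1)
        ultimately show ?thesis by linarith
      qed
      obtain x0 where x0: "P x0 y" using True by blast
      have "t \<le> 3 * M * r0"
        using lower[OF x0] x0 M2 by (smt (verit) P_def atLeastAtMost_iff mult_left_mono)
      then have "6 / \<kappa> * t \<le> 6 / \<kappa> * (3 * M * r0)" using \<kappa> by (intro mult_left_mono) auto
      then have "ennreal (6 / \<kappa> * t) \<le> ennreal (18 * M / \<kappa> * r0)"
        by (intro ennreal_leI) (simp add: algebra_simps)
      then have R: "ennreal (6 / \<kappa> * infdist y (frontier \<Omega>)) < ediameter (frontier \<Omega>)"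
        using r0 by (simp add: t_def \<delta>_def)
      have "2 \<le> \<kappa> * M" using M \<kappa> by (simp add: field_simps)
      then have "2 * \<delta> x0 \<le> \<kappa> * M * \<delta> x0"
        by (intro mult_right_mono) (auto simp: \<delta>_def infdist_nonneg)
      then have t\<epsilon>: "\<epsilon> \<le> t" using x0 by (simp add: P_def inner_region_def \<delta>_def t_def algebra_simps)
      have "(\<integral>\<^sup>+ x. k x y \<partial>?L) \<le> (\<integral>\<^sup>+ x. ennreal ((t / (3 * M)) powr (- (d + \<alpha>)) * \<bar>f y\<bar> powr p) * indicator ?T x \<partial>?L)"
      proof (rule nn_integral_mono)
        fix x assume "x \<in> space ?L"
        then have x: "x \<in> \<Omega>" by (simp add: sp)
        show "k x y \<le> ennreal ((t / (3 * M)) powr (- (d + \<alpha>)) * \<bar>f y\<bar> powr p) * indicator ?T x"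
        proof (cases "P x y")
          case True
          have "\<delta> x powr (- (d + \<alpha>)) \<le> (t / (3 * M)) powr (- (d + \<alpha>))"
            using lower[OF True] t M2 \<alpha> by (intro powr_mono2') (auto simp: d_def field_simps)
          moreover have "x \<in> ?T" using True x y by (simp add: P_def)
          ultimately show ?thesis
            using True by (simp add: k_eq ennreal_leI mult_right_mono)
        qed (simp add: k_eq)
      qed
      also have "\<dots> = ennreal ((t / (3 * M)) powr (- (d + \<alpha>)) * \<bar>f y\<bar> powr p) * emeasure ?L ?T"
        by (rule nn_integral_cmult_indicator[OF T_sets])
      also have "\<dots> \<le> ennreal ((t / (3 * M)) powr (- (d + \<alpha>)) * \<bar>f y\<bar> powr p) *
          ennreal (C * (unit_ball_vol d * (6 / \<kappa> * t) powr d) * (3 * M) powr (- q))"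
        using emeasure_inner_region_preimage_le[OF \<Omega> \<kappa> M y R C]
        by (intro mult_left_mono) (auto simp: d_def t_def \<delta>_def)
      also have "\<dots> = ennreal (((t / (3 * M)) powr (- (d + \<alpha>)) * \<bar>f y\<bar> powr p) *
          (C * (unit_ball_vol d * (6 / \<kappa> * t) powr d) * (3 * M) powr (- q)))"
        by (rule ennreal_mult'[symmetric]) simp
      also have "((t / (3 * M)) powr (- (d + \<alpha>)) * \<bar>f y\<bar> powr p) *
          (C * (unit_ball_vol d * (6 / \<kappa> * t) powr d) * (3 * M) powr (- q))
          = ?B * (\<bar>f y\<bar> powr p / t powr \<alpha>)"
      proof -
        have 1: "(t / (3 * M)) powr (- (d + \<alpha>)) = (3 * M) powr (d + \<alpha>) * t powr (- (d + \<alpha>))"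
          using t M2 by (simp only: powr_divide powr_minus) (simp add: divide_inverse)
        have 2: "(6 / \<kappa> * t) powr d = (6 / \<kappa>) powr d * t powr d"
          using t \<kappa> by (subst powr_mult) simp_all
        have 3: "t powr (- (d + \<alpha>)) * t powr d = 1 / t powr \<alpha>"
          using t by (simp add: powr_add[symmetric] powr_minus_divide)
        have 4: "(3 * M) powr (d + \<alpha>) * (3 * M) powr (- q) = (3 * M) powr (d + \<alpha> - q)"
          using M2 by (simp add: powr_add[symmetric])
        have "((t / (3 * M)) powr (- (d + \<alpha>)) * \<bar>f y\<bar> powr p) *
            (C * (unit_ball_vol d * (6 / \<kappa> * t) powr d) * (3 * M) powr (- q))
          = C * unit_ball_vol d * (6 / \<kappa>) powr d * ((3 * M) powr (d + \<alpha>) * (3 * M) powr (- q)) *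
            (\<bar>f y\<bar> powr p * (t powr (- (d + \<alpha>)) * t powr d))"
          unfolding 1 2 by (simp only: mult_ac)
        then show ?thesis unfolding 3 4 by simp
      qed
      finally show ?thesis
        using t\<epsilon> C0 by (simp add: t_def d_def ennreal_mult'[symmetric] ennreal_mult''[symmetric])
    qed
  qed
  also have "\<dots> = ennreal ?B * (\<integral>\<^sup>+ y. ennreal (\<bar>f y\<bar> powr p / \<delta> y powr \<alpha>) * indicator {\<epsilon>..} (\<delta> y) \<partial>?L)"
    by (intro nn_integral_cmult) measurable
  finally show ?thesis .
qed

section \<open>Absorption\<close>
lemma contracting_scale_exists:
  fixes B \<kappa> \<beta> :: real
  assumes "0 \<le> B" "0 < \<beta>"
  obtains M where "2 / \<kappa> \<le> M" "0 < M" "B * M powr (- \<beta>) \<le> 1 / 2"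
proof -
  \<comment> \<open>The second entry makes \<open>M\<^sup>\<beta> \<ge> 2 B + 1\<close>; the summand 1 keeps it positive when \<open>B = 0\<close>.\<close>
  define M where "M = max (2 / \<kappa>) ((2 * B + 1) powr (1 / \<beta>))"
  have M: "(2 * B + 1) powr (1 / \<beta>) \<le> M" by (simp add: M_def)
  have pos: "0 < (2 * B + 1) powr (1 / \<beta>)" using assms by simp
  have "2 * B + 1 = ((2 * B + 1) powr (1 / \<beta>)) powr \<beta>"
    using assms by (simp add: powr_powr)
  also have "\<dots> \<le> M powr \<beta>" using M assms by (intro powr_mono2) auto
  finally have b: "2 * B + 1 \<le> M powr \<beta>" .
  have "B * M powr (- \<beta>) = B / M powr \<beta>" by (simp add: powr_minus_divide)
  also have "\<dots> \<le> 1 / 2" using b assms by (simp add: divide_le_eq)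
  finally have "B * M powr (- \<beta>) \<le> 1 / 2" .
  moreover have "2 / \<kappa> \<le> M" by (simp add: M_def)
  moreover have "0 < M" using M pos by linarith
  ultimately show ?thesis using that by blast
qed

text \<open>
  The hypotheses on \<open>M\<close> make the factor in front of the transferred mass at most \<open>1/2\<close>. Those on \<open>r0\<close>
  allow plumpness at scale \<open>M \<delta> x\<close> and the codimension condition whenever \<open>\<delta> x \<le> r0\<close>; where \<open>\<delta> x\<close>
  is larger, the weight is at most \<open>r0\<^sup>-\<^sup>\<alpha>\<close>. The bound is independent of \<open>\<epsilon>\<close>.
\<close>
lemma hardy_away_from_boundary:
  fixes \<Omega> :: "'a::euclidean_space set" and \<alpha> C q :: real
  defines "\<delta> \<equiv> \<lambda>x. infdist x (frontier \<Omega>)" and "d \<equiv> real DIM('a)"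
  defines "K p \<kappa> \<equiv> averaging_const DIM('a) p \<kappa>"
  assumes \<Omega>: "bounded \<Omega>" "open \<Omega>" "plump \<kappa> \<Omega>" and p: "0 \<le> p" and \<alpha>: "0 \<le> \<alpha>"
    and C0: "0 \<le> C"
    and C: "assouad_thin (frontier \<Omega>) q C"
    and M: "2 / \<kappa> \<le> M"
      "K p \<kappa> * (C * unit_ball_vol d * (6 / \<kappa>) powr d * 3 powr (d + \<alpha> - q)) * M powr (\<alpha> - q) \<le> 1 / 2"
    and r0: "0 < r0" "ennreal (M * r0) < ediameter \<Omega>"
      "ennreal (18 * M / \<kappa> * r0) < ediameter (frontier \<Omega>)"
    and f: "f \<in> borel_measurable (lebesgue_on \<Omega>)" and \<epsilon>: "0 < \<epsilon>"
    and fin: "(\<integral>\<^sup>+ x. ennreal (\<bar>f x\<bar> powr p) \<partial>lebesgue_on \<Omega>) < top"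
  shows "(\<integral>\<^sup>+ x. ennreal (\<bar>f x\<bar> powr p / \<delta> x powr \<alpha>) * indicator {\<epsilon>..} (\<delta> x) \<partial>lebesgue_on \<Omega>)
    \<le> 2 * (ennreal (r0 powr (- \<alpha>)) * (\<integral>\<^sup>+ x. ennreal (\<bar>f x\<bar> powr p) \<partial>lebesgue_on \<Omega>)
        + ennreal (K p \<kappa> * 2 powr (d + \<alpha>) * M powr \<alpha>) *
          (\<integral>\<^sup>+ x. gagliardo_density \<alpha> p \<Omega> f x \<partial>lebesgue_on \<Omega>))"
    (is "?I \<le> 2 * (?c1 * ?P + ?c2 * ?G)")
proof (rule le_twice_of_le_plus_half)
  let ?L = "lebesgue_on \<Omega>"
  let ?h = "\<lambda>x. ennreal (\<bar>f x\<bar> powr p / \<delta> x powr \<alpha>) * indicator {\<epsilon>..} (\<delta> x)"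
  let ?J = "\<lambda>x. indicator {\<epsilon>..r0} (\<delta> x) * (\<integral>\<^sup>+ y. transfer_kernel \<kappa> \<Omega> M \<alpha> p f x y \<partial>?L)"
  let ?c3 = "ennreal (K p \<kappa> * M powr (- d))"
  have \<kappa>: "0 < \<kappa>" "\<kappa> < 1" using \<Omega> by (auto simp: plump_def)
  have "2 < 2 / \<kappa>" using \<kappa> by (simp add: less_divide_eq)
  with M have M2: "2 < M" by linarith
  have K: "0 \<le> K p \<kappa>" by (simp add: K_def averaging_const_def)
  interpret L: sigma_finite_measure ?L by (rule sigma_finite_lebesgue_on_bounded_open[OF \<Omega>(1,2)])
  have \<delta>_meas: "\<delta> \<in> borel_measurable ?L" unfolding \<delta>_def by (rule measurable_on_lebesgue_infdist)
  note [measurable] = f \<delta>_meas transfer_kernel_measurable[OF f] gagliardo_density_measurable[OF \<Omega>(1,2) f]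
  have \<delta>_pos: "0 < \<delta> x" if "x \<in> \<Omega>" for x
    using infdist_frontier_pos[OF \<Omega>(1,2) that] by (simp add: \<delta>_def)
  have far: "?h x \<le> ennreal (r powr (- \<alpha>)) * ennreal (\<bar>f x\<bar> powr p)" if "0 < r" "r \<le> \<delta> x" for x r
  proof -
    have "\<bar>f x\<bar> powr p / \<delta> x powr \<alpha> = \<delta> x powr (- \<alpha>) * \<bar>f x\<bar> powr p"
      by (simp add: powr_minus_divide)
    also have "\<dots> \<le> r powr (- \<alpha>) * \<bar>f x\<bar> powr p"
      using that \<alpha> by (intro mult_right_mono powr_mono2') auto
    finally have "ennreal (\<bar>f x\<bar> powr p / \<delta> x powr \<alpha>) \<le> ennreal (r powr (- \<alpha>)) * ennreal (\<bar>f x\<bar> powr p)"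
      by (simp add: ennreal_mult'[symmetric] ennreal_leI)
    then show ?thesis by (auto simp: indicator_def)
  qed
  have "?I \<le> (\<integral>\<^sup>+ x. ennreal (\<epsilon> powr (- \<alpha>)) * ennreal (\<bar>f x\<bar> powr p) \<partial>?L)"
  proof (rule nn_integral_mono)
    fix x show "?h x \<le> ennreal (\<epsilon> powr (- \<alpha>)) * ennreal (\<bar>f x\<bar> powr p)"
      using far[OF \<epsilon>, of x] by (cases "\<epsilon> \<le> \<delta> x") auto
  qed
  also have "\<dots> = ennreal (\<epsilon> powr (- \<alpha>)) * ?P" by (intro nn_integral_cmult) measurable
  also have "\<dots> < top" using fin by (simp add: ennreal_mult_less_top)
  finally show "?I < top" .
  \<comment> \<open>For \<open>\<delta> x\<close> in \<open>{\<epsilon>..r0}\<close> the last two summands suffice, elsewhere the first does.\<close>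
  have "?I \<le> (\<integral>\<^sup>+ x. (?c1 * ennreal (\<bar>f x\<bar> powr p) + ?c2 * gagliardo_density \<alpha> p \<Omega> f x) + ?c3 * ?J x \<partial>?L)"
  proof (rule nn_integral_mono)
    fix x assume "x \<in> space ?L"
    then have x: "x \<in> \<Omega>" by simp
    show "?h x \<le> (?c1 * ennreal (\<bar>f x\<bar> powr p) + ?c2 * gagliardo_density \<alpha> p \<Omega> f x) + ?c3 * ?J x"
    proof (cases "\<epsilon> \<le> \<delta> x \<and> \<delta> x \<le> r0")
      case True
      have "ennreal (M * \<delta> x) \<le> ennreal (M * r0)"
        using True M2 by (intro ennreal_leI mult_left_mono) auto
      then have "ennreal (M * infdist x (frontier \<Omega>)) < ediameter \<Omega>"
        using r0(2) by (simp add: \<delta>_def)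
      then have "ennreal (\<bar>f x\<bar> powr p / \<delta> x powr \<alpha>)
          \<le> ?c2 * gagliardo_density \<alpha> p \<Omega> f x + ?c3 * (\<integral>\<^sup>+ y. transfer_kernel \<kappa> \<Omega> M \<alpha> p f x y \<partial>?L)"
        using hardy_density_le_transfer[OF \<Omega> x _ _ f p \<alpha>, of M] M2 by (simp add: K_def \<delta>_def d_def)
      also have "\<dots> = ?c2 * gagliardo_density \<alpha> p \<Omega> f x + ?c3 * ?J x"
        using True by simp
      also have "\<dots> \<le> (?c1 * ennreal (\<bar>f x\<bar> powr p) + ?c2 * gagliardo_density \<alpha> p \<Omega> f x) + ?c3 * ?J x"
        by (intro add_right_mono) simp
      finally show ?thesis using True by simp
    next
      case False
      then consider "\<delta> x < \<epsilon>" | "r0 \<le> \<delta> x" by linarith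
      then have "?h x \<le> ?c1 * ennreal (\<bar>f x\<bar> powr p)"
      proof cases
        case 2 then show ?thesis by (rule far[OF r0(1)])
      qed simp
      then show ?thesis by (simp add: add.assoc add_increasing2)
    qed
  qed
  also have "\<dots> = (?c1 * ?P + ?c2 * ?G) + ?c3 * (\<integral>\<^sup>+ x. ?J x \<partial>?L)"
    by (simp add: nn_integral_add nn_integral_cmult)
  also have "\<dots> \<le> (?c1 * ?P + ?c2 * ?G) + ennreal (1/2) * ?I"
  proof (rule add_left_mono)
    let ?B = "C * unit_ball_vol d * (6 / \<kappa>) powr d * (3 * M) powr (d + \<alpha> - q)"
    have "?c3 * (\<integral>\<^sup>+ x. ?J x \<partial>?L) \<le> ?c3 * (ennreal ?B * ?I)"
      using transfer_kernel_integral_le[OF \<Omega>(1,2) \<kappa> M(1) r0(3) f \<alpha> C0 C]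
      by (intro mult_left_mono) (simp_all add: \<delta>_def d_def)
    also have "\<dots> = ennreal (K p \<kappa> * M powr (- d) * ?B) * ?I"
      using K by (simp add: ennreal_mult' mult.assoc)
    also have "\<dots> \<le> ennreal (1/2) * ?I"
    proof (intro mult_right_mono ennreal_leI)
      have 1: "(3 * M) powr (d + \<alpha> - q) = 3 powr (d + \<alpha> - q) * M powr (d + \<alpha> - q)"
        using M2 by (simp add: powr_mult)
      have 2: "M powr (- d) * M powr (d + \<alpha> - q) = M powr (\<alpha> - q)"
        by (subst powr_add[symmetric]) simp
      have "K p \<kappa> * M powr (- d) * ?B
          = K p \<kappa> * (C * unit_ball_vol d * (6 / \<kappa>) powr d * 3 powr (d + \<alpha> - q)) *
            (M powr (- d) * M powr (d + \<alpha> - q))"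
        unfolding 1 by (simp only: mult_ac)
      then show "K p \<kappa> * M powr (- d) * ?B \<le> 1/2" using M(2) unfolding 2 by (simp only:)
    qed simp
    finally show "?c3 * (\<integral>\<^sup>+ x. ?J x \<partial>?L) \<le> ennreal (1/2) * ?I" .
  qed
  finally show "?I \<le> (?c1 * ?P + ?c2 * ?G) + ennreal (1/2) * ?I" .
qed

lemma nn_integral_le_of_truncations:
  fixes h :: "'b \<Rightarrow> ennreal" and \<delta> :: "'b \<Rightarrow> real"
  assumes [measurable]: "h \<in> borel_measurable L" "\<delta> \<in> borel_measurable L"
    and pos: "\<And>x. x \<in> space L \<Longrightarrow> 0 < \<delta> x"
    and bound: "\<And>\<epsilon>. 0 < \<epsilon> \<Longrightarrow> (\<integral>\<^sup>+ x. h x * indicator {\<epsilon>..} (\<delta> x) \<partial>L) \<le> A"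
  shows "(\<integral>\<^sup>+ x. h x \<partial>L) \<le> A"
proof -
  let ?\<epsilon> = "\<lambda>n. inverse (real (Suc n))"
  let ?g = "\<lambda>n x. h x * indicator {?\<epsilon> n..} (\<delta> x)"
  have sup: "h x = (SUP n. ?g n x)" if x: "x \<in> space L" for x
  proof (rule antisym)
    obtain n where "?\<epsilon> n < \<delta> x" using reals_Archimedean[OF pos[OF x]] by blast
    then have "h x \<le> ?g n x" by (simp add: less_imp_le)
    then show "h x \<le> (SUP n. ?g n x)" by (rule SUP_upper2[OF UNIV_I])
    show "(SUP n. ?g n x) \<le> h x" by (rule SUP_least) (simp add: indicator_def)
  qed
  have "incseq ?g"
  proof (intro incseq_SucI le_funI mult_left_mono)
    fix n x
    have "?\<epsilon> (Suc n) \<le> ?\<epsilon> n" by (intro le_imp_inverse_le) auto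
    then have "{?\<epsilon> n..} \<subseteq> {?\<epsilon> (Suc n)..}" unfolding atLeast_subset_iff .
    then show "(indicator {?\<epsilon> n..} (\<delta> x) :: ennreal) \<le> indicator {?\<epsilon> (Suc n)..} (\<delta> x)"
      by (simp only: indicator_def subset_eq split: if_split) auto
  qed simp
  have "(\<integral>\<^sup>+ x. h x \<partial>L) = (\<integral>\<^sup>+ x. (SUP n. ?g n x) \<partial>L)"
    by (intro nn_integral_cong sup)
  also have "\<dots> = (SUP n. (\<integral>\<^sup>+ x. ?g n x \<partial>L))"
    by (intro nn_integral_monotone_convergence_SUP \<open>incseq ?g\<close>) measurable
  also have "\<dots> \<le> A"
    by (intro SUP_least bound) simp
  finally show ?thesis .
qed

theorem theorem4:
  fixes s p \<kappa> :: real and \<Omega> :: "'a::euclidean_space set"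
  assumes "0 < s" and "s < 1" and "1 \<le> p"
    and "0 < \<kappa>" and "\<kappa> < 1"
    and "\<Omega> \<noteq> {}" and "bounded \<Omega>" and "open \<Omega>" and "plump \<kappa> \<Omega>"
    and "ereal (s * p) < lower_assouad_codim (frontier \<Omega>)"
  shows "\<exists>c::real. 0 \<le> c \<and> (\<forall>f \<in> frac_sobolev s p \<Omega>.
    (\<integral>\<^sup>+ x. ennreal (\<bar>f x\<bar> powr p / infdist x (frontier \<Omega>) powr (s * p)) \<partial>lebesgue_on \<Omega>)
      \<le> ennreal c * ennreal_powr (frac_sobolev_norm s p \<Omega> f) p \<and>
    ennreal c * ennreal_powr (frac_sobolev_norm s p \<Omega> f) p < top)"
proof -
  let ?E = "frontier \<Omega>" and ?L = "lebesgue_on \<Omega>"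
  define d where "d = real DIM('a)"
  define \<alpha> where "\<alpha> = s * p"
  define K where "K = averaging_const DIM('a) p \<kappa>"
  have \<alpha>: "0 \<le> \<alpha>" and p: "0 \<le> p" "0 < p" using assms(1,3) by (auto simp: \<alpha>_def)
  have K: "0 \<le> K" by (simp add: K_def averaging_const_def)
  obtain q C where q: "\<alpha> < q" and "1 \<le> C"
    and C: "assouad_thin ?E q C"
    using assms(10) unfolding lower_assouad_codim_def less_Sup_iff \<alpha>_def assouad_thin_def by auto
  then have C0: "0 \<le> C" by simp
  define B where "B = K * (C * unit_ball_vol d * (6 / \<kappa>) powr d * 3 powr (d + \<alpha> - q))"
  have "0 \<le> B" using K C0 by (simp add: B_def d_def)
  moreover have "0 < q - \<alpha>" using q by simp
  ultimately obtain M where M: "2 / \<kappa> \<le> M" "0 < M" "B * M powr (- (q - \<alpha>)) \<le> 1 / 2"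
    by (rule contracting_scale_exists)
  obtain u v where uv: "u \<in> ?E" "v \<in> ?E" "u \<noteq> v"
    using frontier_bounded_open_two_points assms(6-8) by metis
  obtain x where x: "x \<in> \<Omega>" using assms(6) by blast
  have "\<Omega> \<noteq> {x}" using assms(8) not_open_singleton[of x] by metis
  then obtain y where y: "y \<in> \<Omega>" "x \<noteq> y" using x by blast
  define D where "D = min (dist u v) (dist x y) / 2"
  have D: "0 < D" using uv y by (simp add: D_def)
  have "0 < dist u v" "0 < dist x y" using uv y by simp_all
  then have Dlt: "D < dist u v" "D < dist x y" unfolding D_def by linarith+
  have DE: "ennreal D < ediameter ?E"
    using uv Dlt(1) by (rule ediameter_gt_of_distinct)
  have D\<Omega>: "ennreal D < ediameter \<Omega>"
    using x y Dlt(2) by (rule ediameter_gt_of_distinct)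
  \<comment> \<open>The threshold is dictated by the radius at most \<open>18 M r0 / \<kappa>\<close> at which the codimension condition is used.\<close>
  define r0 where "r0 = D * \<kappa> / (18 * M)"
  have r0: "0 < r0" using D M assms(4) by (simp add: r0_def)
  have "18 * M / \<kappa> * r0 = D" using M(2) assms(4) by (simp add: r0_def)
  with DE have r0E: "ennreal (18 * M / \<kappa> * r0) < ediameter ?E" by simp
  have "M * r0 \<le> D"
  proof -
    have "M * r0 = D * (\<kappa> / 18)" using M(2) by (simp add: r0_def)
    also have "\<dots> \<le> D * 1" using D assms(5) by (intro mult_left_mono) auto
    finally show ?thesis by simp
  qed
  with D\<Omega> have r0\<Omega>: "ennreal (M * r0) < ediameter \<Omega>"
    by (meson ennreal_leI le_less_trans)
  define c1 where "c1 = r0 powr (- \<alpha>)"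
  define c2 where "c2 = K * 2 powr (d + \<alpha>) * M powr \<alpha>"
  have c: "0 \<le> c1" "0 \<le> c2" using K by (auto simp: c1_def c2_def)
  show ?thesis
  proof (intro exI[of _ "2 * (c1 + c2)"] conjI ballI)
    show "0 \<le> 2 * (c1 + c2)" using c by simp
  next
    fix f assume f: "f \<in> frac_sobolev s p \<Omega>"
    then have fm: "f \<in> borel_measurable ?L" and N: "frac_sobolev_norm s p \<Omega> f < top"
      by (auto simp: frac_sobolev_def frac_sobolev_norm_def)
    let ?W = "ennreal_powr (frac_sobolev_norm s p \<Omega> f) p"
    let ?P = "\<integral>\<^sup>+ x. ennreal (\<bar>f x\<bar> powr p) \<partial>?L"
    let ?G = "\<integral>\<^sup>+ x. gagliardo_density \<alpha> p \<Omega> f x \<partial>?L"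
    have W: "?W < top" using N by (rule ennreal_powr_less_top)
    then show "ennreal (2 * (c1 + c2)) * ?W < top" by (simp add: ennreal_mult_less_top)
    have P: "?P \<le> ?W"
      by (rule le_ennreal_powr_of_root_le[OF p(2) _ N]) (simp add: frac_sobolev_norm_def Lp_norm_on_def)
    have G: "?G \<le> ?W"
      by (rule le_ennreal_powr_of_root_le[OF p(2) _ N])
         (simp add: frac_sobolev_norm_def gagliardo_seminorm_def gagliardo_density_def \<alpha>_def)
    have "(\<integral>\<^sup>+ x. ennreal (\<bar>f x\<bar> powr p / infdist x ?E powr \<alpha>) \<partial>?L) \<le> 2 * (ennreal c1 * ?P + ennreal c2 * ?G)"
    proof (rule nn_integral_le_of_truncations[where \<delta> = "\<lambda>x. infdist x ?E"])
      note [measurable] = fm measurable_on_lebesgue_infdist[of ?E \<Omega>]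
      show "(\<lambda>x. ennreal (\<bar>f x\<bar> powr p / infdist x ?E powr \<alpha>)) \<in> borel_measurable ?L" by measurable
      show "(\<lambda>x. infdist x ?E) \<in> borel_measurable ?L" by measurable
      show "0 < infdist x ?E" if "x \<in> space ?L" for x
        using that infdist_frontier_pos assms(7,8) by simp
      show "(\<integral>\<^sup>+ x. ennreal (\<bar>f x\<bar> powr p / infdist x ?E powr \<alpha>) * indicator {\<epsilon>..} (infdist x ?E) \<partial>?L)
          \<le> 2 * (ennreal c1 * ?P + ennreal c2 * ?G)" if "0 < \<epsilon>" for \<epsilon>
      proof -
        have "?P < top" using P W by (rule le_less_trans)
        then show ?thesis
          using hardy_away_from_boundary[OF assms(7-9) p(1) \<alpha> C0 C M(1) _ r0 r0\<Omega> r0E fm that] M(3)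
          by (simp add: c1_def c2_def B_def K_def d_def)
      qed
    qed
    also have "\<dots> \<le> 2 * (ennreal c1 * ?W + ennreal c2 * ?W)"
      by (intro mult_left_mono add_mono P G) auto
    also have "\<dots> = ennreal (2 * (c1 + c2)) * ?W"
      using c by (simp add: ennreal_mult distrib_right mult.assoc)
    finally show "(\<integral>\<^sup>+ x. ennreal (\<bar>f x\<bar> powr p / infdist x ?E powr (s * p)) \<partial>?L)
        \<le> ennreal (2 * (c1 + c2)) * ?W" by (simp add: \<alpha>_def)
  qed
qed

end
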